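(* Let $\phi:\mathbb{U}\to\mathbb{U}$ be analytic and let $\psi$ be analytic on $\mathbb{U}$ such that $W_{\psi,\phi}$ is bounded on $H^2(\mathbb{U})$. Suppose that $\phi$ has a fixed point $p\in\mathbb{U}$ and that $W_{\psi,\phi}$ is normal. Then the spectrum of $W_{\psi,\phi}$ is the closure of $\{\psi(p)\phi'(p)^n : n=0,1,2,\ldots\}$.
   Context: $\mathbb{U}$ is the open unit disc in $\mathbb{C}$. $H^2(\mathbb{U})$ is the Hardy space of analytic functions on $\mathbb{U}$ with square-summable Maclaurin coefficients, a Hilbert space with inner product $\langle f,g\rangle=\sum_{n\ge 0}\hat f(n)\overline{\hat g(n)}$, where $\hat f(n)$ are the Maclaurin coefficients. The weighted composition operator is $W_{\psi,\phi}f=\psi\cdot(f\circ\phi)$. The convention $0^0=1$ is used. *)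

theory Defs
  imports "HOL-Complex_Analysis.Complex_Analysis"
begin

abbreviation unit_disc :: "complex set" where
  "unit_disc \<equiv> ball 0 1"

abbreviation maclaurin_coeff :: "(complex \<Rightarrow> complex) \<Rightarrow> nat \<Rightarrow> complex" where
  "maclaurin_coeff f n \<equiv> fps_nth (fps_expansion f 0) n"

(* A function on the disc is represented by its extension by 0 to the whole plane, so that
   equality of elements of the Hardy space is equality of HOL functions. *)

definition hardy_space :: "(complex \<Rightarrow> complex) set" where
  "hardy_space = {f. f holomorphic_on unit_disc \<and> (\<forall>z. z \<notin> unit_disc \<longrightarrow> f z = 0) \<and>
                     summable (\<lambda>n. (cmod (maclaurin_coeff f n))\<^sup>2)}"

definition hardy_inner :: "(complex \<Rightarrow> complex) \<Rightarrow> (complex \<Rightarrow> complex) \<Rightarrow> complex" where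
  "hardy_inner f g = (\<Sum>n. maclaurin_coeff f n * cnj (maclaurin_coeff g n))"

definition hardy_norm :: "(complex \<Rightarrow> complex) \<Rightarrow> real" where
  "hardy_norm f = sqrt (Re (hardy_inner f f))"

type_synonym operator = "(complex \<Rightarrow> complex) \<Rightarrow> (complex \<Rightarrow> complex)"

(* Operators are only constrained on the Hardy space; their values elsewhere are irrelevant. *)

definition bounded_operator :: "operator \<Rightarrow> bool" where
  "bounded_operator T \<longleftrightarrow>
     (\<forall>f\<in>hardy_space. T f \<in> hardy_space) \<and>
     (\<forall>f\<in>hardy_space. \<forall>g\<in>hardy_space. T (\<lambda>z. f z + g z) = (\<lambda>z. T f z + T g z)) \<and>
     (\<forall>c. \<forall>f\<in>hardy_space. T (\<lambda>z. c * f z) = (\<lambda>z. c * T f z)) \<and>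
     (\<exists>C. \<forall>f\<in>hardy_space. hardy_norm (T f) \<le> C * hardy_norm f)"

(* For a bounded operator the element h below exists and is unique by the Riesz
   representation theorem. *)

definition adjoint_operator :: "operator \<Rightarrow> operator" where
  "adjoint_operator T g =
     (THE h. h \<in> hardy_space \<and> (\<forall>f\<in>hardy_space. hardy_inner (T f) g = hardy_inner f h))"

definition normal_operator :: "operator \<Rightarrow> bool" where
  "normal_operator T \<longleftrightarrow> bounded_operator T \<and>
     (\<forall>f\<in>hardy_space. T (adjoint_operator T f) = adjoint_operator T (T f))"

definition operator_spectrum :: "operator \<Rightarrow> complex set" where
  "operator_spectrum T =
     {l. \<not> (\<exists>S. bounded_operator S \<and>
               (\<forall>f\<in>hardy_space. S (\<lambda>z. T f z - l * f z) = f \<and>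
                                 (\<lambda>z. T (S f) z - l * S f z) = f))}"

definition weighted_composition ::
    "(complex \<Rightarrow> complex) \<Rightarrow> (complex \<Rightarrow> complex) \<Rightarrow> operator" where
  "weighted_composition \<psi> \<phi> f = (\<lambda>z. if z \<in> unit_disc then \<psi> z * f (\<phi> z) else 0)"

end

theory Submission
  imports Defs
begin

text \<open>
  Let \<open>\<lambda>\<^sub>n = \<psi>(p) \<phi>'(p)\<^sup>n\<close> and write \<open>W\<close> for the weighted composition operator. Since \<open>\<phi>\<close> fixes \<open>p\<close>,
  \<open>W\<close> preserves the space \<open>V\<^sub>n\<close> of functions vanishing to order \<open>n\<close> at \<open>p\<close> and multiplies their \<open>n\<close>-th
  Taylor coefficient at \<open>p\<close> by \<open>\<lambda>\<^sub>n\<close>. Orthonormalizing the vectors that represent the Taylor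
  coefficients yields an orthonormal family \<open>e\<^sub>n\<close>, total because a function with vanishing Taylor
  series is zero, for which \<open>V\<^sub>n\<close> is the orthogonal complement of \<open>e\<^sub>0, \<dots>, e\<^sub>n\<^sub>-\<^sub>1\<close>. If those \<open>e\<^sub>j\<close> are
  eigenvectors of \<open>W\<close>, then \<open>e\<^sub>n\<close> is an eigenvector of the adjoint, hence by normality one of \<open>W\<close> with
  eigenvalue \<open>\<lambda>\<^sub>n\<close>. So \<open>W\<close> is diagonal in the basis \<open>e\<^sub>n\<close>, and its spectrum is the closure of its
  eigenvalues.
\<close>

subsection \<open>Square-summable sequences and the Hardy space\<close>

lemma square_summable_mult:
  fixes a b :: "nat \<Rightarrow> complex"
  assumes a: "summable (\<lambda>n. (cmod (a n))\<^sup>2)" and b: "summable (\<lambda>n. (cmod (b n))\<^sup>2)"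
  shows "summable (\<lambda>n. cmod (a n * b n))"
proof (rule summable_comparison_test'[OF summable_add[OF a b]])
  fix n
  have "2 * (cmod (a n) * cmod (b n)) \<le> (cmod (a n))\<^sup>2 + (cmod (b n))\<^sup>2"
    using sum_squares_bound[of "cmod (a n)" "cmod (b n)"] by (simp add: mult.assoc)
  moreover have "0 \<le> cmod (a n) * cmod (b n)" by simp
  ultimately have "cmod (a n) * cmod (b n) \<le> (cmod (a n))\<^sup>2 + (cmod (b n))\<^sup>2"
    by linarith
  then show "norm (cmod (a n * b n)) \<le> (cmod (a n))\<^sup>2 + (cmod (b n))\<^sup>2"
    by (simp add: norm_mult)
qed

text \<open>The finite inequality for \<open>L2_set\<close> bounds every partial sum. With no
  conjugate in the product, both the Hardy inner product and the evaluation of a power series are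
  instances.\<close>

lemma square_summable_Cauchy_Schwarz:
  fixes a b :: "nat \<Rightarrow> complex"
  assumes a: "summable (\<lambda>n. (cmod (a n))\<^sup>2)" and b: "summable (\<lambda>n. (cmod (b n))\<^sup>2)"
  shows "cmod (\<Sum>n. a n * b n) \<le> sqrt (\<Sum>n. (cmod (a n))\<^sup>2) * sqrt (\<Sum>n. (cmod (b n))\<^sup>2)"
proof -
  have sm: "summable (\<lambda>n. cmod (a n * b n))"
    by (rule square_summable_mult[OF a b])
  have "(\<Sum>n. cmod (a n * b n)) \<le> sqrt (\<Sum>n. (cmod (a n))\<^sup>2) * sqrt (\<Sum>n. (cmod (b n))\<^sup>2)"
  proof (rule suminf_le_const[OF sm])
    fix N
    have "(\<Sum>n<N. cmod (a n * b n)) \<le> L2_set (\<lambda>n. cmod (a n)) {..<N} * L2_set (\<lambda>n. cmod (b n)) {..<N}"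
      using L2_set_mult_ineq[of "\<lambda>n. cmod (a n)" "\<lambda>n. cmod (b n)" "{..<N}"] by (simp add: norm_mult)
    also have "\<dots> \<le> sqrt (\<Sum>n. (cmod (a n))\<^sup>2) * sqrt (\<Sum>n. (cmod (b n))\<^sup>2)"
      unfolding L2_set_def
      by (intro mult_mono real_sqrt_le_mono sum_le_suminf a b) (auto intro: sum_nonneg suminf_nonneg a b)
    finally show "(\<Sum>n<N. cmod (a n * b n)) \<le> sqrt (\<Sum>n. (cmod (a n))\<^sup>2) * sqrt (\<Sum>n. (cmod (b n))\<^sup>2)" .
  qed
  with summable_norm[OF sm] show ?thesis by linarith
qed

lemma square_summable_add:
  fixes a b :: "nat \<Rightarrow> complex"
  assumes a: "summable (\<lambda>n. (cmod (a n))\<^sup>2)" and b: "summable (\<lambda>n. (cmod (b n))\<^sup>2)"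
  shows "summable (\<lambda>n. (cmod (a n + b n))\<^sup>2)"
proof (rule summable_comparison_test'[OF summable_mult[OF summable_add[OF a b], of 2]])
  fix n
  have "(cmod (a n + b n))\<^sup>2 \<le> (cmod (a n) + cmod (b n))\<^sup>2"
    by (intro power_mono norm_triangle_ineq) simp
  also have "\<dots> \<le> 2 * ((cmod (a n))\<^sup>2 + (cmod (b n))\<^sup>2)"
    using sum_squares_bound[of "cmod (a n)" "cmod (b n)"] by (simp add: power2_sum)
  finally show "norm ((cmod (a n + b n))\<^sup>2) \<le> 2 * ((cmod (a n))\<^sup>2 + (cmod (b n))\<^sup>2)" by simp
qed

text \<open>On square-summable sequences this inverts \<open>maclaurin_coeff\<close>. The value 0
  off the disc matches the representation chosen in \<open>hardy_space\<close>.\<close>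

definition hardy_of_coeffs :: "(nat \<Rightarrow> complex) \<Rightarrow> complex \<Rightarrow> complex" where
  "hardy_of_coeffs a z = (if z \<in> unit_disc then \<Sum>n. a n * z ^ n else 0)"

lemma norm_power_square: "(cmod (z ^ n))\<^sup>2 = ((cmod z)\<^sup>2) ^ n"
  by (simp add: norm_power power_mult[symmetric] mult.commute)

lemma square_summable_sums_hardy_of_coeffs:
  assumes a: "summable (\<lambda>n. (cmod (a n))\<^sup>2)" and z: "z \<in> unit_disc"
  shows "(\<lambda>n. a n * z ^ n) sums hardy_of_coeffs a z"
proof -
  \<comment> \<open>The powers of a point of the disc are square-summable as a geometric series, so
    the product with \<open>a\<close> converges absolutely.\<close>
  have "summable (\<lambda>n. (cmod (z ^ n))\<^sup>2)"
    using z by (simp add: norm_power_square abs_square_less_1)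
  from summable_norm_cancel[OF square_summable_mult[OF a this]] show ?thesis
    using z by (simp add: hardy_of_coeffs_def summable_sums)
qed

lemma
  assumes a: "summable (\<lambda>n. (cmod (a n))\<^sup>2)"
  shows maclaurin_coeff_hardy_of_coeffs: "maclaurin_coeff (hardy_of_coeffs a) = a"
    and hardy_of_coeffs_in_hardy_space: "hardy_of_coeffs a \<in> hardy_space"
proof -
  have "hardy_of_coeffs a has_fps_expansion Abs_fps a"
  proof (rule has_fps_expansionI)
    have "eventually (\<lambda>u. u \<in> unit_disc) (nhds 0)"
      by (intro eventually_nhds_in_open) auto
    then show "eventually (\<lambda>u. (\<lambda>n. fps_nth (Abs_fps a) n * u ^ n) sums hardy_of_coeffs a u) (nhds 0)"
      by eventually_elim (use square_summable_sums_hardy_of_coeffs[OF a] in simp)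
  qed
  from fps_expansion_eqI[OF this] show coeff: "maclaurin_coeff (hardy_of_coeffs a) = a"
    by simp
  have "hardy_of_coeffs a holomorphic_on unit_disc"
    by (rule power_series_holomorphic[where a = a])
       (use square_summable_sums_hardy_of_coeffs[OF a] in simp)
  with coeff a show "hardy_of_coeffs a \<in> hardy_space"
    by (auto simp: hardy_space_def hardy_of_coeffs_def)
qed

lemma hardy_sums:
  assumes "f \<in> hardy_space" "z \<in> unit_disc"
  shows "(\<lambda>n. maclaurin_coeff f n * z ^ n) sums f z"
  using holomorphic_power_series[of f 0 1 z] assms by (simp add: hardy_space_def fps_expansion_def)

lemma hardy_eqI:
  assumes "f \<in> hardy_space" "g \<in> hardy_space" "\<And>n. maclaurin_coeff f n = maclaurin_coeff g n"
  shows "f = g"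
proof
  fix z show "f z = g z"
  proof (cases "z \<in> unit_disc")
    case True
    with hardy_sums[of f z] hardy_sums[of g z] assms show ?thesis
      by (simp add: sums_iff)
  next
    case False
    with assms show ?thesis by (auto simp: hardy_space_def)
  qed
qed

lemma hardy_has_fps_expansion:
  assumes "f \<in> hardy_space"
  shows "f has_fps_expansion fps_expansion f 0"
  using assms by (intro has_fps_expansion_fps_expansion[of unit_disc]) (auto simp: hardy_space_def)

lemma
  assumes f: "f \<in> hardy_space" and g: "g \<in> hardy_space"
  shows maclaurin_coeff_add: "maclaurin_coeff (\<lambda>z. f z + g z) n = maclaurin_coeff f n + maclaurin_coeff g n"
    and hardy_space_add [intro]: "(\<lambda>z. f z + g z) \<in> hardy_space"
proof -
  show c: "maclaurin_coeff (\<lambda>z. f z + g z) n = maclaurin_coeff f n + maclaurin_coeff g n" for n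
    using fps_expansion_eqI[OF has_fps_expansion_add[OF f[THEN hardy_has_fps_expansion] g[THEN hardy_has_fps_expansion]]]
    by simp
  show "(\<lambda>z. f z + g z) \<in> hardy_space"
    using f g unfolding hardy_space_def by (auto simp: c intro!: holomorphic_intros square_summable_add)
qed

lemma
  assumes f: "f \<in> hardy_space"
  shows maclaurin_coeff_cmult: "maclaurin_coeff (\<lambda>z. c * f z) n = c * maclaurin_coeff f n"
    and hardy_space_cmult [intro]: "(\<lambda>z. c * f z) \<in> hardy_space"
proof -
  show c: "maclaurin_coeff (\<lambda>z. c * f z) n = c * maclaurin_coeff f n" for n
    using fps_expansion_eqI[OF has_fps_expansion_cmult_left[OF f[THEN hardy_has_fps_expansion]]]
    by simp
  show "(\<lambda>z. c * f z) \<in> hardy_space"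
    using f unfolding hardy_space_def
    by (auto simp: c norm_mult power_mult_distrib intro!: holomorphic_intros summable_mult)
qed

lemma hardy_space_zero [intro, simp]: "(\<lambda>z. 0) \<in> hardy_space"
  using fps_expansion_eqI[of "\<lambda>_::complex. 0::complex" 0] by (simp add: hardy_space_def)

lemma hardy_space_diff [intro]:
  assumes "f \<in> hardy_space" "g \<in> hardy_space"
  shows "(\<lambda>z. f z - g z) \<in> hardy_space"
  using hardy_space_add[OF assms(1) hardy_space_cmult[OF assms(2), of "-1"]] by simp

lemma hardy_space_sum [intro]:
  assumes "\<And>i. i \<in> A \<Longrightarrow> f i \<in> hardy_space"
  shows "(\<lambda>z. \<Sum>i\<in>A. f i z) \<in> hardy_space"
  using assms by (induction A rule: infinite_finite_induct) auto

section \<open>Inner product, norm and point evaluation\<close>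

lemma hardy_inner_summable:
  assumes "f \<in> hardy_space" "g \<in> hardy_space"
  shows "summable (\<lambda>n. maclaurin_coeff f n * cnj (maclaurin_coeff g n))"
  using assms by (intro summable_norm_cancel[OF square_summable_mult]) (auto simp: hardy_space_def)

lemma hardy_inner_add_left:
  assumes "f \<in> hardy_space" "g \<in> hardy_space" "h \<in> hardy_space"
  shows "hardy_inner (\<lambda>z. f z + g z) h = hardy_inner f h + hardy_inner g h"
  using assms by (simp add: hardy_inner_def maclaurin_coeff_add distrib_right suminf_add hardy_inner_summable)

lemma hardy_inner_cmult_left:
  assumes "f \<in> hardy_space" "h \<in> hardy_space"
  shows "hardy_inner (\<lambda>z. c * f z) h = c * hardy_inner f h"
  using suminf_mult[OF hardy_inner_summable[OF assms], of c]
  by (simp add: hardy_inner_def maclaurin_coeff_cmult[OF assms(1)] mult.assoc)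

lemma hardy_inner_commute:
  assumes "f \<in> hardy_space" "g \<in> hardy_space"
  shows "hardy_inner g f = cnj (hardy_inner f g)"
  using sums_cnj[THEN iffD2, OF summable_sums[OF hardy_inner_summable[OF assms]]]
  by (simp add: hardy_inner_def sums_iff mult.commute)

lemma hardy_inner_diff_left:
  assumes "f \<in> hardy_space" "g \<in> hardy_space" "h \<in> hardy_space"
  shows "hardy_inner (\<lambda>z. f z - g z) h = hardy_inner f h - hardy_inner g h"
  using hardy_inner_add_left[OF assms(1) hardy_space_cmult[OF assms(2), of "-1"] assms(3)]
    hardy_inner_cmult_left[OF assms(2,3), of "-1"] by simp

lemma hardy_inner_zero_left [simp]: "h \<in> hardy_space \<Longrightarrow> hardy_inner (\<lambda>z. 0) h = 0"
  using hardy_inner_cmult_left[of "\<lambda>z. 0" h 0] by simp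

lemma hardy_inner_sum_left:
  assumes "\<And>i. i \<in> A \<Longrightarrow> f i \<in> hardy_space" "h \<in> hardy_space"
  shows "hardy_inner (\<lambda>z. \<Sum>i\<in>A. f i z) h = (\<Sum>i\<in>A. hardy_inner (f i) h)"
  using assms by (induction A rule: infinite_finite_induct) (simp_all add: hardy_inner_add_left hardy_space_sum)

lemma hardy_inner_diff_right:
  assumes "f \<in> hardy_space" "g \<in> hardy_space" "h \<in> hardy_space"
  shows "hardy_inner h (\<lambda>z. f z - g z) = hardy_inner h f - hardy_inner h g"
  using assms hardy_inner_commute[of "\<lambda>z. f z - g z" h] hardy_inner_commute[of f h] hardy_inner_commute[of g h]
  by (simp add: hardy_inner_diff_left hardy_space_diff)

lemma hardy_inner_cmult_right:
  assumes "f \<in> hardy_space" "h \<in> hardy_space"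
  shows "hardy_inner h (\<lambda>z. c * f z) = cnj c * hardy_inner h f"
  using assms hardy_inner_commute[of "\<lambda>z. c * f z" h] hardy_inner_commute[of f h]
  by (simp add: hardy_inner_cmult_left hardy_space_cmult)

lemma hardy_inner_sum_right:
  assumes "\<And>i. i \<in> A \<Longrightarrow> f i \<in> hardy_space" "h \<in> hardy_space"
  shows "hardy_inner h (\<lambda>z. \<Sum>i\<in>A. f i z) = (\<Sum>i\<in>A. hardy_inner h (f i))"
proof -
  have "hardy_inner h (\<lambda>z. \<Sum>i\<in>A. f i z) = cnj (\<Sum>i\<in>A. hardy_inner (f i) h)"
    using assms hardy_inner_commute[of "\<lambda>z. \<Sum>i\<in>A. f i z" h]
    by (simp add: hardy_inner_sum_left hardy_space_sum)
  also have "\<dots> = (\<Sum>i\<in>A. hardy_inner h (f i))"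
    unfolding cnj_sum using assms by (intro sum.cong refl hardy_inner_commute[symmetric])
  finally show ?thesis .
qed

lemma hardy_inner_self:
  assumes "f \<in> hardy_space"
  shows "hardy_inner f f = of_real (\<Sum>n. (cmod (maclaurin_coeff f n))\<^sup>2)"
proof -
  have "summable (\<lambda>n. (cmod (maclaurin_coeff f n))\<^sup>2)"
    using assms by (simp add: hardy_space_def)
  from sums_of_real[OF summable_sums[OF this], where 'a = complex] show ?thesis
    unfolding hardy_inner_def by (simp only: complex_norm_square sums_iff)
qed

lemma hardy_norm_eq:
  assumes "f \<in> hardy_space"
  shows "hardy_norm f = sqrt (\<Sum>n. (cmod (maclaurin_coeff f n))\<^sup>2)"
  by (simp add: hardy_norm_def hardy_inner_self[OF assms])

lemma hardy_norm_nonneg [simp]: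
  assumes "f \<in> hardy_space"
  shows "hardy_norm f \<ge> 0"
  using assms by (simp add: hardy_norm_eq hardy_space_def suminf_nonneg)

lemma hardy_inner_eq_norm_square:
  assumes "f \<in> hardy_space"
  shows "hardy_inner f f = of_real ((hardy_norm f)\<^sup>2)"
  using assms by (simp add: hardy_norm_eq hardy_inner_self hardy_space_def suminf_nonneg)

lemma hardy_norm_eq_0_iff:
  assumes "f \<in> hardy_space"
  shows "hardy_norm f = 0 \<longleftrightarrow> f = (\<lambda>z. 0)"
proof
  assume "hardy_norm f = 0"
  moreover have s: "summable (\<lambda>n. (cmod (maclaurin_coeff f n))\<^sup>2)"
    using assms by (simp add: hardy_space_def)
  ultimately have "maclaurin_coeff f n = 0" for n
    using suminf_eq_zero_iff[OF s] hardy_norm_eq[OF assms] by simp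
  then show "f = (\<lambda>z. 0)"
    using assms maclaurin_coeff_cmult[of "\<lambda>z. 0" 0] by (intro hardy_eqI) auto
next
  assume "f = (\<lambda>z. 0)"
  then show "hardy_norm f = 0" by (simp add: hardy_norm_def)
qed

lemma hardy_Cauchy_Schwarz:
  assumes "f \<in> hardy_space" "g \<in> hardy_space"
  shows "cmod (hardy_inner f g) \<le> hardy_norm f * hardy_norm g"
  using square_summable_Cauchy_Schwarz[of "maclaurin_coeff f" "\<lambda>n. cnj (maclaurin_coeff g n)"] assms
  by (simp add: hardy_norm_eq hardy_inner_def) (simp add: hardy_space_def)

lemma hardy_norm_cmult:
  assumes "f \<in> hardy_space"
  shows "hardy_norm (\<lambda>z. c * f z) = cmod c * hardy_norm f"
proof -
  have "summable (\<lambda>n. (cmod (maclaurin_coeff f n))\<^sup>2)"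
    using assms by (simp add: hardy_space_def)
  from suminf_mult[OF this, of "(cmod c)\<^sup>2"] show ?thesis
    using assms by (simp add: hardy_norm_eq hardy_space_cmult maclaurin_coeff_cmult norm_mult
        power_mult_distrib real_sqrt_mult)
qed

text \<open>Cauchy-Schwarz for the coefficients of \<open>f\<close> against the powers of
  \<open>z\<close>, whose squared moduli sum to 1 / (1 - |z|^2). The bound is uniform on closed
  discs, as the Cauchy estimate at \<open>p\<close> requires.\<close>

lemma hardy_point_bound:
  assumes f: "f \<in> hardy_space" and z: "cmod z \<le> r" and r: "r < 1"
  shows "cmod (f z) \<le> hardy_norm f / sqrt (1 - r\<^sup>2)"
proof -
  have z1: "cmod z < 1" using z r by simp
  then have z2: "(cmod z)\<^sup>2 < 1" by (simp add: abs_square_less_1)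
  have r0: "0 \<le> r" using z norm_ge_zero[of z] by linarith
  then have r2: "r\<^sup>2 < 1" using r by (simp add: abs_square_less_1)
  have "summable (\<lambda>n. (cmod (z ^ n))\<^sup>2)" using z2 by (simp add: norm_power_square)
  from square_summable_Cauchy_Schwarz[OF _ this, of "maclaurin_coeff f"]
  have "cmod (f z) \<le> hardy_norm f * sqrt (\<Sum>n. ((cmod z)\<^sup>2) ^ n)"
    using f hardy_sums[OF f, of z] z1 by (simp add: sums_iff norm_power_square hardy_norm_eq) (simp add: hardy_space_def)
  also have "\<dots> = hardy_norm f / sqrt (1 - (cmod z)\<^sup>2)"
    using z2 by (simp add: suminf_geometric real_sqrt_divide)
  also have "\<dots> \<le> hardy_norm f / sqrt (1 - r\<^sup>2)"
    using z z2 r2 f by (intro divide_left_mono) (auto intro!: power_mono)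
  finally show ?thesis .
qed

subsection \<open>Riesz representation and adjoints\<close>

text \<open>A functional with bound \<open>C\<close>, evaluated at its own representing vector,
  yields the third assumption. Dividing by the norm then bounds that vector by
  \<open>C\<close>.\<close>

lemma hardy_norm_le_squareI:
  assumes "f \<in> hardy_space" "0 \<le> C" "(hardy_norm f)\<^sup>2 \<le> C * hardy_norm f"
  shows "hardy_norm f \<le> C"
proof (cases "hardy_norm f = 0")
  case False
  with hardy_norm_nonneg[OF assms(1)] have "0 < hardy_norm f" by simp
  with assms(3) show ?thesis by (simp add: power2_eq_square)
qed (use assms in simp)

lemma hardy_inner_eqI:
  assumes "f \<in> hardy_space" "g \<in> hardy_space"
    and "\<And>h. h \<in> hardy_space \<Longrightarrow> hardy_inner h f = hardy_inner h g"
  shows "f = g"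
proof -
  have d: "(\<lambda>z. f z - g z) \<in> hardy_space" using assms by auto
  have "hardy_inner (\<lambda>z. f z - g z) (\<lambda>z. f z - g z) = 0"
    using assms(3)[OF d] by (simp add: hardy_inner_diff_right assms d)
  then have "hardy_norm (\<lambda>z. f z - g z) = 0"
    by (simp add: hardy_norm_def)
  then have "(\<lambda>z. f z - g z) = (\<lambda>z. 0)"
    by (simp add: hardy_norm_eq_0_iff[OF d])
  then show ?thesis by (simp add: fun_eq_iff)
qed

lemma square_summable_truncate: "summable (\<lambda>n. (cmod (if n < N then a n else 0))\<^sup>2)"
  by (rule summable_finite[of "{..<N}"]) auto

text \<open>A truncated series is a finite combination of monomials, so linearity expands
  \<open>L\<close> by induction on \<open>N\<close>.\<close>

lemma hardy_truncation_functional: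
  fixes L :: "(complex \<Rightarrow> complex) \<Rightarrow> complex"
  assumes add: "\<And>f g. f \<in> hardy_space \<Longrightarrow> g \<in> hardy_space \<Longrightarrow> L (\<lambda>z. f z + g z) = L f + L g"
    and cmult: "\<And>c f. f \<in> hardy_space \<Longrightarrow> L (\<lambda>z. c * f z) = c * L f"
  shows "L (hardy_of_coeffs (\<lambda>n. if n < N then a n else 0))
           = (\<Sum>k<N. a k * L (hardy_of_coeffs (\<lambda>n. if n = k then 1 else 0)))"
proof (induction N)
  case 0
  have "hardy_of_coeffs (\<lambda>n. 0) = (\<lambda>z. 0)"
    by (simp add: hardy_of_coeffs_def fun_eq_iff)
  with cmult[of "\<lambda>z. 0" 0] show ?case by simp
next
  case (Suc N)
  let ?t = "\<lambda>N. hardy_of_coeffs (\<lambda>n. if n < N then a n else 0)"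
  let ?m = "hardy_of_coeffs (\<lambda>n. if n = N then 1 else 0)"
  have m: "summable (\<lambda>n. (cmod (if n = N then 1 else 0))\<^sup>2)"
    by (rule summable_finite[of "{N}"]) auto
  note H = hardy_of_coeffs_in_hardy_space[OF m] hardy_of_coeffs_in_hardy_space[OF square_summable_truncate]
  have "?t (Suc N) = (\<lambda>z. ?t N z + a N * ?m z)"
    by (rule hardy_eqI)
       (auto elim: less_SucE simp: H hardy_space_add hardy_space_cmult maclaurin_coeff_add maclaurin_coeff_cmult
         maclaurin_coeff_hardy_of_coeffs[OF m] maclaurin_coeff_hardy_of_coeffs[OF square_summable_truncate])
  then show ?case
    using Suc by (simp add: H add cmult hardy_space_cmult)
qed

text \<open>The representing vector is built from its coefficients, which are dictated by the values
  of \<open>L\<close> on monomials. Testing \<open>L\<close> on truncations shows that they are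
  square-summable, and continuity extends the representation from truncations to all
  \<open>f\<close>.\<close>

lemma hardy_Riesz:
  fixes L :: "(complex \<Rightarrow> complex) \<Rightarrow> complex"
  assumes add: "\<And>f g. f \<in> hardy_space \<Longrightarrow> g \<in> hardy_space \<Longrightarrow> L (\<lambda>z. f z + g z) = L f + L g"
    and cmult: "\<And>c f. f \<in> hardy_space \<Longrightarrow> L (\<lambda>z. c * f z) = c * L f"
    and bound: "\<And>f. f \<in> hardy_space \<Longrightarrow> cmod (L f) \<le> C * hardy_norm f" and C: "0 \<le> C"
  obtains h where "h \<in> hardy_space" "\<And>f. f \<in> hardy_space \<Longrightarrow> L f = hardy_inner f h" "hardy_norm h \<le> C"
proof -
  \<comment> \<open>The conjugate compensates for the conjugation of the second argument of the
    inner product.\<close>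
  define c where "c = (\<lambda>k. cnj (L (hardy_of_coeffs (\<lambda>n. if n = k then 1 else 0))))"
  define t where "t = (\<lambda>a N. hardy_of_coeffs (\<lambda>n. if n < N then a n else 0))"
  have t: "t a N \<in> hardy_space" "maclaurin_coeff (t a N) = (\<lambda>n. if n < N then a n else 0)" for a N
    unfolding t_def by (auto simp: hardy_of_coeffs_in_hardy_space[OF square_summable_truncate]
        maclaurin_coeff_hardy_of_coeffs[OF square_summable_truncate])
  have Lt: "L (t a N) = (\<Sum>k<N. a k * cnj (c k))" for a N
    unfolding t_def c_def complex_cnj_cnj by (rule hardy_truncation_functional[of L, OF add cmult])
  have sum_if: "(\<lambda>n. if n < N then b n else 0) sums (\<Sum>n<N. b n)" for b :: "nat \<Rightarrow> real" and N
    using sums_If_finite_set[of "{..<N}" b] by simp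
  \<comment> \<open>At the truncation of \<open>c\<close> itself, \<open>L\<close> takes the value
    of the squared norm, so the bound on \<open>L\<close> bounds this norm by
    \<open>C\<close>.\<close>
  have partial: "(\<Sum>n<N. (cmod (c n))\<^sup>2) \<le> C\<^sup>2" for N
  proof -
    have "(\<lambda>n. (cmod (if n < N then c n else 0))\<^sup>2) = (\<lambda>n. if n < N then (cmod (c n))\<^sup>2 else 0)"
      by auto
    then have norm: "(hardy_norm (t c N))\<^sup>2 = (\<Sum>n<N. (cmod (c n))\<^sup>2)"
      using sum_if[of N "\<lambda>n. (cmod (c n))\<^sup>2"] by (simp add: hardy_norm_eq t sums_iff sum_nonneg)
    have "L (t c N) = of_real (\<Sum>n<N. (cmod (c n))\<^sup>2)"
      by (simp add: Lt complex_norm_square[symmetric])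
    then have "cmod (L (t c N)) = \<bar>\<Sum>n<N. (cmod (c n))\<^sup>2\<bar>"
      by (metis norm_of_real)
    then have "cmod (L (t c N)) = (hardy_norm (t c N))\<^sup>2"
      unfolding norm by (simp add: sum_nonneg)
    with bound[OF t(1), of c N] have "hardy_norm (t c N) \<le> C"
      by (intro hardy_norm_le_squareI t C) simp
    then show ?thesis
      unfolding norm[symmetric] by (intro power_mono) (simp_all add: t)
  qed
  have c: "summable (\<lambda>n. (cmod (c n))\<^sup>2)"
    by (rule bounded_imp_summable[of _ "C\<^sup>2"], simp, metis partial lessThan_Suc_atMost)
  define h where "h = hardy_of_coeffs c"
  have h: "h \<in> hardy_space" "maclaurin_coeff h = c"
    unfolding h_def by (simp_all add: c hardy_of_coeffs_in_hardy_space maclaurin_coeff_hardy_of_coeffs)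
  have rep: "L f = hardy_inner f h" if f: "f \<in> hardy_space" for f
  proof -
    let ?a = "maclaurin_coeff f"
    have a: "summable (\<lambda>n. (cmod (?a n))\<^sup>2)" using f by (simp add: hardy_space_def)
    \<comment> \<open>The tails \<open>r N\<close> tend to 0 in norm, hence \<open>L (r N)\<close>
      tends to 0 and the values of \<open>L\<close> at the truncations converge to
      \<open>L f\<close>.\<close>
    define r where "r = (\<lambda>N z. f z - t ?a N z)"
    have r: "r N \<in> hardy_space" for N unfolding r_def using f t by auto
    have f_eq: "f = (\<lambda>z. t ?a N z + r N z)" for N by (simp add: r_def)
    have coeff_r: "maclaurin_coeff (r N) n = (if n < N then 0 else ?a n)" for n N
      using maclaurin_coeff_add[OF t(1) r, of ?a N N n] f_eq[of N] t(2) by (auto split: if_splits)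
    have norm_r: "hardy_norm (r N) = sqrt ((\<Sum>n. (cmod (?a n))\<^sup>2) - (\<Sum>n<N. (cmod (?a n))\<^sup>2))" for N
    proof -
      have "(\<lambda>n. (cmod (?a n))\<^sup>2 - (if n < N then (cmod (?a n))\<^sup>2 else 0))
              = (\<lambda>n. (cmod (maclaurin_coeff (r N) n))\<^sup>2)"
        by (auto simp: coeff_r)
      with sums_diff[OF summable_sums[OF a] sum_if[of N "\<lambda>n. (cmod (?a n))\<^sup>2"]]
      show ?thesis by (simp add: hardy_norm_eq[OF r] sums_iff)
    qed
    have "(\<lambda>N. sqrt ((\<Sum>n. (cmod (?a n))\<^sup>2) - (\<Sum>n<N. (cmod (?a n))\<^sup>2)))
            \<longlonglongrightarrow> sqrt ((\<Sum>n. (cmod (?a n))\<^sup>2) - (\<Sum>n. (cmod (?a n))\<^sup>2))"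
      by (intro tendsto_intros summable_LIMSEQ a)
    then have "(\<lambda>N. C * hardy_norm (r N)) \<longlonglongrightarrow> 0"
      unfolding norm_r[symmetric] using tendsto_mult_right_zero by simp
    then have "(\<lambda>N. L (r N)) \<longlonglongrightarrow> 0"
      by (rule Lim_null_comparison[rotated]) (simp add: bound r)
    moreover have "L (r N) = L f - (\<Sum>k<N. ?a k * cnj (c k))" for N
      using add[OF t(1) r, of ?a N N] f_eq[of N] by (simp add: Lt)
    ultimately have "(\<lambda>N. L f - (\<Sum>k<N. ?a k * cnj (c k))) \<longlonglongrightarrow> 0" by simp
    from tendsto_diff[OF tendsto_const this, of "L f"] have "(\<lambda>k. ?a k * cnj (c k)) sums L f"
      by (simp add: sums_def)
    then show ?thesis by (simp add: hardy_inner_def h(2) sums_iff)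
  qed
  \<comment> \<open>The bound on \<open>L\<close> at \<open>h\<close> reads |h|^2 \<le> C
    |h|.\<close>
  have "cmod (hardy_inner h h) = (hardy_norm h)\<^sup>2"
    by (simp add: hardy_inner_eq_norm_square[OF h(1)] norm_power h)
  with bound[OF h(1)] rep[OF h(1)] have "hardy_norm h \<le> C"
    by (intro hardy_norm_le_squareI h C) simp
  with h rep show thesis by (intro that) auto
qed

section \<open>Adjoints of bounded operators and eigenvectors of normal ones\<close>

lemma bounded_operator_nonneg_bound:
  assumes "bounded_operator T"
  obtains C where "0 \<le> C" "\<And>f. f \<in> hardy_space \<Longrightarrow> hardy_norm (T f) \<le> C * hardy_norm f"
proof -
  from assms obtain C where C: "\<And>f. f \<in> hardy_space \<Longrightarrow> hardy_norm (T f) \<le> C * hardy_norm f"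
    unfolding bounded_operator_def by blast
  have "hardy_norm (T f) \<le> max C 0 * hardy_norm f" if "f \<in> hardy_space" for f
    using C[OF that] mult_right_mono[OF max.cobounded1[of C 0] hardy_norm_nonneg[OF that]] by linarith
  then show thesis by (intro that[of "max C 0"]) simp_all
qed

text \<open>Riesz representation of the functional sending \<open>f\<close> to
  \<open>hardy_inner (T f) g\<close>, which is bounded by \<open>C * hardy_norm g\<close>. Vectors
  with the same inner products coincide, so the description in \<open>adjoint_operator\<close> is
  unique.\<close>

lemma
  assumes T: "bounded_operator T" and g: "g \<in> hardy_space"
  shows adjoint_operator_in_hardy_space: "adjoint_operator T g \<in> hardy_space"
    and hardy_inner_adjoint_operator:
      "f \<in> hardy_space \<Longrightarrow> hardy_inner (T f) g = hardy_inner f (adjoint_operator T g)"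
proof -
  obtain C where C: "0 \<le> C" "\<And>f. f \<in> hardy_space \<Longrightarrow> hardy_norm (T f) \<le> C * hardy_norm f"
    using T by (rule bounded_operator_nonneg_bound) blast
  have TH: "T f \<in> hardy_space" if "f \<in> hardy_space" for f
    using T that by (simp add: bounded_operator_def)
  obtain h where h: "h \<in> hardy_space" "\<And>f. f \<in> hardy_space \<Longrightarrow> hardy_inner (T f) g = hardy_inner f h"
  proof (rule hardy_Riesz[of "\<lambda>f. hardy_inner (T f) g" "C * hardy_norm g"])
    fix f assume f: "f \<in> hardy_space"
    have "cmod (hardy_inner (T f) g) \<le> hardy_norm (T f) * hardy_norm g"
      by (rule hardy_Cauchy_Schwarz[OF TH[OF f] g])
    also have "\<dots> \<le> C * hardy_norm f * hardy_norm g"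
      by (rule mult_right_mono[OF C(2)[OF f] hardy_norm_nonneg[OF g]])
    finally show "cmod (hardy_inner (T f) g) \<le> C * hardy_norm g * hardy_norm f"
      by (simp add: mult_ac)
  qed (use T TH g C in \<open>auto simp: bounded_operator_def hardy_inner_add_left hardy_inner_cmult_left\<close>)
  have "adjoint_operator T g = h"
    unfolding adjoint_operator_def
  proof (rule the_equality)
    show "h \<in> hardy_space \<and> (\<forall>f\<in>hardy_space. hardy_inner (T f) g = hardy_inner f h)"
      using h by blast
    fix k assume "k \<in> hardy_space \<and> (\<forall>f\<in>hardy_space. hardy_inner (T f) g = hardy_inner f k)"
    with h show "k = h" by (intro hardy_inner_eqI) auto
  qed
  with h show "adjoint_operator T g \<in> hardy_space"
    "f \<in> hardy_space \<Longrightarrow> hardy_inner (T f) g = hardy_inner f (adjoint_operator T g)" by simp_all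
qed

text \<open>Assumption \<open>adj\<close> says that \<open>e\<close> is an eigenvector of the
  adjoint for \<open>cnj c\<close>. Normality then makes the norm of \<open>T e - c e\<close> equal
  to that of the adjoint expression, which is 0. The proof expands the squared norm and cancels its
  four terms, each of modulus |c|^2 |e|^2.\<close>

lemma normal_operator_eigenvector:
  assumes T: "normal_operator T" and e: "e \<in> hardy_space"
    and adj: "\<And>f. f \<in> hardy_space \<Longrightarrow> hardy_inner (T f) e = c * hardy_inner f e"
  shows "T e = (\<lambda>z. c * e z)"
proof -
  have bT: "bounded_operator T" using T by (simp add: normal_operator_def)
  then have Te: "T e \<in> hardy_space" using e by (simp add: bounded_operator_def)
  note ce = hardy_space_cmult[OF e]
  have "adjoint_operator T e = (\<lambda>z. cnj c * e z)"
    using e ce by (intro hardy_inner_eqI adjoint_operator_in_hardy_space[OF bT])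
      (simp_all add: hardy_inner_adjoint_operator[OF bT e, symmetric] adj hardy_inner_cmult_right)
  \<comment> \<open>Normality enters here, exchanging \<open>T\<close> with its adjoint on
    \<open>e\<close>.\<close>
  then have "adjoint_operator T (T e) = T (\<lambda>z. cnj c * e z)"
    using T e by (metis normal_operator_def)
  also have "\<dots> = (\<lambda>z. cnj c * T e z)"
    using bT e by (simp add: bounded_operator_def)
  finally have 1: "hardy_inner (T e) (T e) = c * hardy_inner e (T e)"
    using hardy_inner_adjoint_operator[OF bT Te e] by (simp add: hardy_inner_cmult_right Te e)
  have 2: "hardy_inner e (T e) = cnj c * hardy_inner e e"
    using hardy_inner_commute[OF Te e] adj[OF e] hardy_inner_commute[OF e e] by simp
  let ?d = "\<lambda>z. T e z - c * e z"
  have d: "?d \<in> hardy_space" using Te ce by auto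
  have "hardy_inner ?d ?d = 0"
    using 1 2 adj[OF e]
    by (simp add: hardy_inner_diff_left hardy_inner_diff_right hardy_inner_cmult_left
        hardy_inner_cmult_right Te e ce d algebra_simps)
  then have "hardy_norm ?d = 0" by (simp add: hardy_norm_def)
  then show ?thesis using hardy_norm_eq_0_iff[OF d] by (simp add: fun_eq_iff)
qed

subsection \<open>Orthonormal families and diagonal operators\<close>

text \<open>Orthonormality is asked only below \<open>N\<close>, so that the lemma applies inside
  the Gram-Schmidt induction, where just the earlier vectors are known to be orthonormal.\<close>

lemma hardy_orthonormal_residual:
  fixes e :: "nat \<Rightarrow> complex \<Rightarrow> complex"
  assumes f: "f \<in> hardy_space" and e: "\<And>n. e n \<in> hardy_space"
    and on: "\<And>m n. m < N \<Longrightarrow> n < N \<Longrightarrow> hardy_inner (e m) (e n) = (if m = n then 1 else 0)"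
    and n: "n < N"
  shows "hardy_inner (\<lambda>z. f z - (\<Sum>j<N. hardy_inner f (e j) * e j z)) (e n) = 0"
proof -
  have "hardy_inner (\<lambda>z. \<Sum>j<N. hardy_inner f (e j) * e j z) (e n)
          = (\<Sum>j<N. hardy_inner f (e j) * hardy_inner (e j) (e n))"
    by (simp add: hardy_inner_sum_left hardy_inner_cmult_left hardy_space_cmult e)
  also have "\<dots> = (\<Sum>j<N. if j = n then hardy_inner f (e n) else 0)"
    by (rule sum.cong) (use n in \<open>auto simp: on\<close>)
  also have "\<dots> = hardy_inner f (e n)"
    using n by simp
  finally show ?thesis
    using f e by (simp add: hardy_inner_diff_left hardy_space_sum hardy_space_cmult)
qed

text \<open>The residual \<open>g\<close> is orthogonal to the projection \<open>?p\<close>, so its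
  squared norm is that of \<open>f\<close> minus the partial sum, and it is nonnegative.\<close>

lemma
  assumes f: "f \<in> hardy_space" and e: "\<And>n. e n \<in> hardy_space"
    and on: "\<And>m n. hardy_inner (e m) (e n) = (if m = n then 1 else 0)"
  shows hardy_Bessel_summable: "summable (\<lambda>n. (cmod (hardy_inner f (e n)))\<^sup>2)"
    and hardy_Bessel_inequality: "(\<Sum>n. (cmod (hardy_inner f (e n)))\<^sup>2) \<le> (hardy_norm f)\<^sup>2"
proof -
  have partial: "(\<Sum>n<N. (cmod (hardy_inner f (e n)))\<^sup>2) \<le> (hardy_norm f)\<^sup>2" for N
  proof -
    let ?p = "\<lambda>z. \<Sum>j<N. hardy_inner f (e j) * e j z"
    define g where "g = (\<lambda>z. f z - ?p z)"
    have p: "?p \<in> hardy_space" and g: "g \<in> hardy_space"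
      unfolding g_def by (simp_all add: f e hardy_space_sum hardy_space_cmult hardy_space_diff)
    have ge: "hardy_inner g (e n) = 0" if "n < N" for n
      unfolding g_def by (rule hardy_orthonormal_residual[OF f e on that])
    have "hardy_inner g ?p = (\<Sum>j<N. cnj (hardy_inner f (e j)) * hardy_inner g (e j))"
      by (simp add: hardy_inner_sum_right hardy_inner_cmult_right hardy_space_cmult e g)
    also have "\<dots> = 0" by (simp add: ge)
    finally have "hardy_inner g g = hardy_inner g f"
      using hardy_inner_diff_right[OF f p g] by (simp add: g_def)
    also have "\<dots> = hardy_inner f f - hardy_inner ?p f"
      unfolding g_def by (rule hardy_inner_diff_left[OF f p f])
    also have "hardy_inner ?p f = (\<Sum>j<N. hardy_inner f (e j) * cnj (hardy_inner f (e j)))"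
      using f e hardy_inner_commute[OF f e]
      by (simp add: hardy_inner_sum_left hardy_inner_cmult_left hardy_space_cmult)
    also have "\<dots> = of_real (\<Sum>j<N. (cmod (hardy_inner f (e j)))\<^sup>2)"
      unfolding of_real_sum by (simp only: complex_norm_square)
    finally have "of_real ((hardy_norm g)\<^sup>2)
        = complex_of_real ((hardy_norm f)\<^sup>2 - (\<Sum>j<N. (cmod (hardy_inner f (e j)))\<^sup>2))"
      by (simp only: hardy_inner_eq_norm_square f g of_real_diff)
    then have "(hardy_norm g)\<^sup>2 = (hardy_norm f)\<^sup>2 - (\<Sum>j<N. (cmod (hardy_inner f (e j)))\<^sup>2)"
      by (simp only: of_real_eq_iff)
    then show ?thesis using zero_le_power2[of "hardy_norm g"] by linarith
  qed
  show sm: "summable (\<lambda>n. (cmod (hardy_inner f (e n)))\<^sup>2)"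
    by (rule bounded_imp_summable[of _ "(hardy_norm f)\<^sup>2"], simp, metis partial lessThan_Suc_atMost)
  show "(\<Sum>n. (cmod (hardy_inner f (e n)))\<^sup>2) \<le> (hardy_norm f)\<^sup>2"
    by (rule suminf_le_const[OF sm partial])
qed

text \<open>By Bessel and Cauchy-Schwarz the functional \<open>?L\<close> is bounded by the l2 norm
  of \<open>d\<close>. Its representing vector has the coordinates \<open>d\<close>, as testing on
  each \<open>e m\<close> shows.\<close>

lemma hardy_Riesz_Fischer:
  assumes e: "\<And>n. e n \<in> hardy_space"
    and on: "\<And>m n. hardy_inner (e m) (e n) = (if m = n then 1 else 0)"
    and d: "summable (\<lambda>n. (cmod (d n))\<^sup>2)"
  obtains h where "h \<in> hardy_space" "\<And>n. hardy_inner h (e n) = d n"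
    "hardy_norm h \<le> sqrt (\<Sum>n. (cmod (d n))\<^sup>2)"
proof -
  let ?L = "\<lambda>g. \<Sum>n. hardy_inner g (e n) * cnj (d n)"
  have d': "summable (\<lambda>n. (cmod (cnj (d n)))\<^sup>2)" using d by simp
  have sm: "summable (\<lambda>n. hardy_inner g (e n) * cnj (d n))" if "g \<in> hardy_space" for g
    by (rule summable_norm_cancel[OF square_summable_mult[OF hardy_Bessel_summable[OF that e on] d']])
  obtain h where h: "h \<in> hardy_space" "\<And>g. g \<in> hardy_space \<Longrightarrow> ?L g = hardy_inner g h"
    "hardy_norm h \<le> sqrt (\<Sum>n. (cmod (d n))\<^sup>2)"
  proof (rule hardy_Riesz[of ?L "sqrt (\<Sum>n. (cmod (d n))\<^sup>2)"])
    fix f g assume f: "f \<in> hardy_space" and g: "g \<in> hardy_space"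
    show "?L (\<lambda>z. f z + g z) = ?L f + ?L g"
      using suminf_add[OF sm[OF f] sm[OF g]] f g e
      by (simp add: hardy_inner_add_left distrib_right)
  next
    fix c f assume f: "f \<in> hardy_space"
    show "?L (\<lambda>z. c * f z) = c * ?L f"
      using suminf_mult[OF sm[OF f], of c] f e by (simp add: hardy_inner_cmult_left mult.assoc)
  next
    fix f assume f: "f \<in> hardy_space"
    have "cmod (?L f) \<le> sqrt (\<Sum>n. (cmod (hardy_inner f (e n)))\<^sup>2) * sqrt (\<Sum>n. (cmod (cnj (d n)))\<^sup>2)"
      by (rule square_summable_Cauchy_Schwarz[OF hardy_Bessel_summable[OF f e on] d'])
    also have "\<dots> \<le> hardy_norm f * sqrt (\<Sum>n. (cmod (cnj (d n)))\<^sup>2)"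
      using hardy_Bessel_inequality[OF f e on] hardy_norm_nonneg[OF f]
      by (intro mult_right_mono real_le_lsqrt) (simp_all add: suminf_nonneg[OF d] d)
    finally show "cmod (?L f) \<le> sqrt (\<Sum>n. (cmod (d n))\<^sup>2) * hardy_norm f"
      by (simp add: mult.commute)
  qed (use d in \<open>auto simp: suminf_nonneg\<close>)
  have "hardy_inner h (e m) = d m" for m
  proof -
    have "hardy_inner (e m) h = (\<Sum>n. if n = m then cnj (d m) else 0)"
      unfolding h(2)[OF e, symmetric] by (intro suminf_cong) (simp add: on)
    also have "\<dots> = cnj (d m)"
      using sums_single[of m "\<lambda>_. cnj (d m)"] by (simp add: sums_iff)
    finally show ?thesis
      using hardy_inner_commute[OF e h(1)] by simp
  qed
  with h show thesis by (intro that) auto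
qed

text \<open>If \<open>x\<close> is a limit of eigenvalues, \<open>T - x\<close> is arbitrarily small
  on unit eigenvectors and has no bounded inverse. Otherwise dividing the coordinates by
  \<open>l n - x\<close> inverts it. Assumption \<open>coeff\<close> is the adjoint form of
  \<open>eigen\<close> and describes \<open>T\<close> in coordinates.\<close>

theorem operator_spectrum_orthonormal_eigenbasis:
  fixes e :: "nat \<Rightarrow> complex \<Rightarrow> complex"
  assumes T: "bounded_operator T" and e: "\<And>n. e n \<in> hardy_space"
    and on: "\<And>m n. hardy_inner (e m) (e n) = (if m = n then 1 else 0)"
    and total: "\<And>f. f \<in> hardy_space \<Longrightarrow> (\<And>n. hardy_inner f (e n) = 0) \<Longrightarrow> f = (\<lambda>z. 0)"
    and eigen: "\<And>n. T (e n) = (\<lambda>z. l n * e n z)"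
    and coeff: "\<And>f n. f \<in> hardy_space \<Longrightarrow> hardy_inner (T f) (e n) = l n * hardy_inner f (e n)"
  shows "operator_spectrum T = closure (range l)"
proof (intro set_eqI iffI)
  fix x assume x: "x \<in> closure (range l)"
  have False if S: "bounded_operator S" and inv: "\<forall>f\<in>hardy_space. S (\<lambda>z. T f z - x * f z) = f" for S
  proof -
    obtain C where C: "0 \<le> C" "\<And>f. f \<in> hardy_space \<Longrightarrow> hardy_norm (S f) \<le> C * hardy_norm f"
      using S by (rule bounded_operator_nonneg_bound) blast
    \<comment> \<open>The tolerance 1 / (C + 1) is positive even for C = 0, and its product with
      \<open>C\<close> stays below 1.\<close>
    obtain n where n: "dist (l n) x < 1 / (C + 1)"
      using x C(1) unfolding closure_approachable by (force dest: spec[of _ "1 / (C + 1)"])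
    have norm_e: "hardy_norm (e n) = 1"
      using on[of n n] by (simp add: hardy_norm_def)
    have "S (\<lambda>z. (l n - x) * e n z) = e n"
      using inv e[of n] by (auto simp: eigen left_diff_distrib)
    then have "1 \<le> C * hardy_norm (\<lambda>z. (l n - x) * e n z)"
      using C(2)[OF hardy_space_cmult[OF e, of "l n - x" n]] norm_e by simp
    also have "\<dots> = C * dist (l n) x"
      by (simp add: hardy_norm_cmult e norm_e dist_norm)
    also have "\<dots> \<le> C * (1 / (C + 1))"
      using n C(1) by (intro mult_left_mono) auto
    also have "\<dots> < 1" using C(1) by simp
    finally show False by simp
  qed
  then show "x \<in> operator_spectrum T"
    unfolding operator_spectrum_def by blast
next
  fix x assume x: "x \<in> operator_spectrum T"
  show "x \<in> closure (range l)"
  proof (rule ccontr)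
    assume "x \<notin> closure (range l)"
    \<comment> \<open>Outside the closure there is a uniform gap \<open>r\<close> to all
      eigenvalues; it makes the divided coordinates square-summable and bounds the resolvent by 1 /
      r.\<close>
    then obtain r where r: "r > 0" "\<And>n. r \<le> cmod (l n - x)"
      unfolding closure_approachable by (auto simp: dist_norm not_less)
    then have lx: "l n - x \<noteq> 0" for n
      by (metis norm_zero not_less)
    \<comment> \<open>By totality the coordinates determine a vector, so linearity of
      \<open>S\<close> and both inverse identities reduce to identities between coordinates.\<close>
    have eqI: "f = g" if f: "f \<in> hardy_space" and g: "g \<in> hardy_space"
      and fg: "\<And>n. hardy_inner f (e n) = hardy_inner g (e n)" for f g
      using total[OF hardy_space_diff[OF f g]] fg f g e by (simp add: hardy_inner_diff_left fun_eq_iff)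
    have "\<forall>f\<in>hardy_space. \<exists>h. h \<in> hardy_space \<and>
            (\<forall>n. hardy_inner h (e n) = hardy_inner f (e n) / (l n - x)) \<and>
            hardy_norm h \<le> 1 / r * hardy_norm f"
    proof
      fix f assume f: "f \<in> hardy_space"
      let ?d = "\<lambda>n. hardy_inner f (e n) / (l n - x)"
      note B = hardy_Bessel_summable[OF f e on]
      have le: "(cmod (?d n))\<^sup>2 \<le> (1 / r)\<^sup>2 * (cmod (hardy_inner f (e n)))\<^sup>2" for n
      proof -
        have "cmod (?d n) \<le> 1 / r * cmod (hardy_inner f (e n))"
          using r(2)[of n] r(1) by (simp add: norm_divide frac_le)
        from power_mono[OF this, of 2] show ?thesis by (simp only: power_mult_distrib norm_ge_zero simp_thms)
      qed
      have d: "summable (\<lambda>n. (cmod (?d n))\<^sup>2)"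
        by (rule summable_comparison_test'[OF summable_mult[OF B, of "(1 / r)\<^sup>2"]]) (use le in simp)
      have "(\<Sum>n. (cmod (?d n))\<^sup>2) \<le> (\<Sum>n. (1 / r)\<^sup>2 * (cmod (hardy_inner f (e n)))\<^sup>2)"
        by (rule suminf_le[OF le d summable_mult[OF B]])
      also have "\<dots> = (1 / r)\<^sup>2 * (\<Sum>n. (cmod (hardy_inner f (e n)))\<^sup>2)"
        by (rule suminf_mult[OF B])
      also have "\<dots> \<le> (1 / r)\<^sup>2 * (hardy_norm f)\<^sup>2"
        by (rule mult_left_mono[OF hardy_Bessel_inequality[OF f e on]]) simp
      also have "\<dots> = (1 / r * hardy_norm f)\<^sup>2"
        by (simp only: power_mult_distrib)
      finally have "sqrt (\<Sum>n. (cmod (?d n))\<^sup>2) \<le> 1 / r * hardy_norm f"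
        using r(1) hardy_norm_nonneg[OF f] by (intro real_le_lsqrt) simp_all
      with hardy_Riesz_Fischer[OF e on d] show "\<exists>h. h \<in> hardy_space \<and>
            (\<forall>n. hardy_inner h (e n) = ?d n) \<and> hardy_norm h \<le> 1 / r * hardy_norm f"
        by (metis order_trans)
    qed
    then obtain S where S: "\<And>f. f \<in> hardy_space \<Longrightarrow> S f \<in> hardy_space"
      "\<And>f n. f \<in> hardy_space \<Longrightarrow> hardy_inner (S f) (e n) = hardy_inner f (e n) / (l n - x)"
      "\<And>f. f \<in> hardy_space \<Longrightarrow> hardy_norm (S f) \<le> 1 / r * hardy_norm f"
      by (auto dest!: bchoice)
    have TH: "T f \<in> hardy_space" if "f \<in> hardy_space" for f
      using T that by (simp add: bounded_operator_def)
    note H = S(1) TH hardy_space_add hardy_space_cmult hardy_space_diff e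
    have "bounded_operator S"
      unfolding bounded_operator_def
    proof (intro conjI ballI allI exI)
      show "S (\<lambda>z. f z + g z) = (\<lambda>z. S f z + S g z)" if "f \<in> hardy_space" "g \<in> hardy_space" for f g
        using that by (intro eqI) (simp_all add: H S(2) hardy_inner_add_left add_divide_distrib)
      show "S (\<lambda>z. c * f z) = (\<lambda>z. c * S f z)" if "f \<in> hardy_space" for c f
        using that by (intro eqI) (simp_all add: H S(2) hardy_inner_cmult_left)
      show "hardy_norm (S f) \<le> 1 / r * hardy_norm f" if "f \<in> hardy_space" for f
        using S(3)[OF that] .
    qed (rule S(1))
    moreover have "S (\<lambda>z. T f z - x * f z) = f" if "f \<in> hardy_space" for f
      using that lx
      by (intro eqI) (simp_all add: H S(2) hardy_inner_diff_left hardy_inner_cmult_left coeff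
          flip: left_diff_distrib)
    moreover have "(\<lambda>z. T (S f) z - x * S f z) = f" if "f \<in> hardy_space" for f
      using that lx
      by (intro eqI) (simp_all add: H S(2) hardy_inner_diff_left hardy_inner_cmult_left coeff
          flip: diff_divide_distrib left_diff_distrib)
    ultimately show False
      using x unfolding operator_spectrum_def by blast
  qed
qed

subsection \<open>Gram--Schmidt orthonormalization\<close>

fun hardy_gram_schmidt :: "(nat \<Rightarrow> complex \<Rightarrow> complex) \<Rightarrow> nat \<Rightarrow> complex \<Rightarrow> complex" where
  "hardy_gram_schmidt K n =
     (let v = (\<lambda>z. K n z - (\<Sum>j<n. hardy_inner (K n) (hardy_gram_schmidt K j) * hardy_gram_schmidt K j z))
      in (\<lambda>z. of_real (1 / hardy_norm v) * v z))"

declare hardy_gram_schmidt.simps [simp del]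

text \<open>Common kernels of functionals take the place of spans. On the common kernel of the
  earlier \<open>K j\<close> the subtracted projection contributes nothing, so there
  \<open>e n\<close> acts as a nonzero multiple of \<open>K n\<close>. Assumption
  \<open>indep\<close> is linear independence in dual form, and all claims go through one induction
  because each needs the others at smaller indices.\<close>

lemma hardy_gram_schmidt_step:
  assumes K: "\<And>n. K n \<in> hardy_space"
    and indep: "\<And>n. \<exists>f\<in>hardy_space. (\<forall>j<n. hardy_inner f (K j) = 0) \<and> hardy_inner f (K n) \<noteq> 0"
  defines "e \<equiv> hardy_gram_schmidt K"
  shows "e n \<in> hardy_space \<and> hardy_inner (e n) (e n) = 1 \<and> (\<forall>j<n. hardy_inner (e n) (e j) = 0) \<and>
    (\<forall>f\<in>hardy_space. (\<forall>j<n. hardy_inner f (e j) = 0) \<longleftrightarrow> (\<forall>j<n. hardy_inner f (K j) = 0)) \<and>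
    (\<exists>c. c \<noteq> 0 \<and> (\<forall>f\<in>hardy_space. (\<forall>j<n. hardy_inner f (K j) = 0) \<longrightarrow>
       hardy_inner f (e n) = c * hardy_inner f (K n)))"
proof (induction n rule: less_induct)
  case (less n)
  \<comment> \<open>The induction hypothesis covers only indices below \<open>n\<close>; padding
    with 0 gives a family lying entirely in the space, as the residual lemma demands.\<close>
  define e' where "e' = (\<lambda>j. if j < n then e j else (\<lambda>z. 0))"
  have e': "e' j \<in> hardy_space" for j using less by (simp add: e'_def)
  have e'_on: "hardy_inner (e' i) (e' j) = (if i = j then 1 else 0)" if "i < n" "j < n" for i j
    using that less[of i] less[of j] hardy_inner_commute[OF e' e', of i j]
    by (cases i j rule: linorder_cases) (auto simp: e'_def)
  define v where "v = (\<lambda>z. K n z - (\<Sum>j<n. hardy_inner (K n) (e' j) * e' j z))"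
  have v: "v \<in> hardy_space"
    unfolding v_def by (simp add: K e' hardy_space_sum hardy_space_cmult hardy_space_diff)
  have "v = (\<lambda>z. K n z - (\<Sum>j<n. hardy_inner (K n) (e j) * e j z))"
    by (simp add: v_def e'_def)
  then have e_n: "e n = (\<lambda>z. of_real (1 / hardy_norm v) * v z)"
    unfolding e_def by (subst hardy_gram_schmidt.simps) (simp add: Let_def)
  \<comment> \<open>For n = m + 1 the kernels agree up to \<open>m\<close> by induction, and the
    nonzero factor relating \<open>e m\<close> to \<open>K m\<close> adds the last
    condition.\<close>
  have kernel: "(\<forall>j<n. hardy_inner f (e j) = 0) \<longleftrightarrow> (\<forall>j<n. hardy_inner f (K j) = 0)"
    if f: "f \<in> hardy_space" for f
  proof (cases n)
    case (Suc m)
    from less[of m] obtain c where c: "c \<noteq> 0"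
      "\<forall>f\<in>hardy_space. (\<forall>j<m. hardy_inner f (K j) = 0) \<longrightarrow> hardy_inner f (e m) = c * hardy_inner f (K m)"
      and iff: "\<forall>f\<in>hardy_space. (\<forall>j<m. hardy_inner f (e j) = 0) \<longleftrightarrow> (\<forall>j<m. hardy_inner f (K j) = 0)"
      using Suc by blast
    with f show ?thesis by (auto simp: Suc less_Suc_eq)
  qed simp
  have inner_v: "hardy_inner f v = hardy_inner f (K n)"
    if f: "f \<in> hardy_space" and 0: "\<forall>j<n. hardy_inner f (K j) = 0" for f
  proof -
    have "hardy_inner f (\<lambda>z. \<Sum>j<n. hardy_inner (K n) (e' j) * e' j z)
            = (\<Sum>j<n. cnj (hardy_inner (K n) (e' j)) * hardy_inner f (e' j))"
      by (simp add: hardy_inner_sum_right hardy_inner_cmult_right hardy_space_cmult e' f)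
    also have "\<dots> = 0"
      using kernel[OF f] 0 by (simp add: e'_def)
    finally show ?thesis
      unfolding v_def by (simp add: hardy_inner_diff_right K e' f hardy_space_sum hardy_space_cmult)
  qed
  \<comment> \<open>The test vector from \<open>indep\<close> has a nonzero product with
    \<open>K n\<close>, hence with \<open>v\<close>.\<close>
  have "v \<noteq> (\<lambda>z. 0)"
  proof
    assume v0: "v = (\<lambda>z. 0)"
    obtain f where f: "f \<in> hardy_space" "\<forall>j<n. hardy_inner f (K j) = 0" "hardy_inner f (K n) \<noteq> 0"
      using indep by blast
    have "hardy_inner f (\<lambda>z. 0) = 0"
      using hardy_inner_cmult_right[of "\<lambda>z. 0" f 0] f(1) by simp
    with inner_v[OF f(1,2)] f(3) v0 show False by simp
  qed
  then have nv: "hardy_norm v \<noteq> 0" by (simp add: hardy_norm_eq_0_iff v)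
  have en: "e n \<in> hardy_space" unfolding e_n by (rule hardy_space_cmult[OF v])
  have "hardy_inner (e n) (e n) = 1"
    unfolding e_n hardy_inner_cmult_left[OF v hardy_space_cmult[OF v]] hardy_inner_cmult_right[OF v v]
    using nv by (simp add: hardy_inner_eq_norm_square[OF v] power2_eq_square)
  moreover have "hardy_inner (e n) (e j) = 0" if "j < n" for j
  proof -
    have "hardy_inner v (e' j) = 0"
      unfolding v_def by (rule hardy_orthonormal_residual[OF K e' e'_on that])
    then show ?thesis
      using that e'[of j] unfolding e_n
      by (subst hardy_inner_cmult_left) (simp_all add: e'_def v)
  qed
  moreover have "hardy_inner f (e n) = of_real (1 / hardy_norm v) * hardy_inner f (K n)"
    if "f \<in> hardy_space" "\<forall>j<n. hardy_inner f (K j) = 0" for f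
    using that unfolding e_n by (subst hardy_inner_cmult_right) (simp_all add: v inner_v)
  moreover have "complex_of_real (1 / hardy_norm v) \<noteq> 0" using nv by simp
  ultimately show ?case using en kernel by blast
qed

lemma hardy_orthonormalization:
  fixes K :: "nat \<Rightarrow> complex \<Rightarrow> complex"
  assumes K: "\<And>n. K n \<in> hardy_space"
    and indep: "\<And>n. \<exists>f\<in>hardy_space. (\<forall>j<n. hardy_inner f (K j) = 0) \<and> hardy_inner f (K n) \<noteq> 0"
  obtains e c where "\<And>n. e n \<in> hardy_space"
    "\<And>m n. hardy_inner (e m) (e n) = (if m = n then 1 else 0)"
    "\<And>f n. f \<in> hardy_space \<Longrightarrow>
       (\<forall>j<n. hardy_inner f (e j) = 0) \<longleftrightarrow> (\<forall>j<n. hardy_inner f (K j) = 0)"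
    "\<And>f n. f \<in> hardy_space \<Longrightarrow> (\<forall>j<n. hardy_inner f (K j) = 0) \<Longrightarrow>
       hardy_inner f (e n) = c n * hardy_inner f (K n)"
proof -
  let ?e = "hardy_gram_schmidt K"
  note step = hardy_gram_schmidt_step[of K, OF K indep]
  have e: "?e n \<in> hardy_space" for n using step by blast
  have "hardy_inner (?e m) (?e n) = (if m = n then 1 else 0)" for m n
    using step[of m] step[of n] hardy_inner_commute[OF e e, of m n]
    by (cases m n rule: linorder_cases) auto
  moreover have "\<forall>n. \<exists>c. \<forall>f\<in>hardy_space. (\<forall>j<n. hardy_inner f (K j) = 0) \<longrightarrow>
       hardy_inner f (?e n) = c * hardy_inner f (K n)"
    using step by blast
  then obtain c where "\<forall>n. \<forall>f\<in>hardy_space. (\<forall>j<n. hardy_inner f (K j) = 0) \<longrightarrow>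
       hardy_inner f (?e n) = c n * hardy_inner f (K n)"
    by metis
  ultimately show thesis
    using e step by (intro that[of ?e c]) blast+
qed

subsection \<open>Taylor coefficients at a fixed point\<close>

abbreviation taylor_coeff :: "(complex \<Rightarrow> complex) \<Rightarrow> complex \<Rightarrow> nat \<Rightarrow> complex" where
  "taylor_coeff f p n \<equiv> fps_nth (fps_expansion f p) n"

lemma has_fps_expansion_at:
  assumes "f holomorphic_on unit_disc" "p \<in> unit_disc"
  shows "(\<lambda>x. f (p + x)) has_fps_expansion fps_expansion f p"
  using assms by (intro analytic_at_imp_has_fps_expansion) (auto simp: analytic_at intro!: exI[of _ unit_disc])

lemma fps_expansion_at_eqI:
  assumes "f holomorphic_on unit_disc" "p \<in> unit_disc" "(\<lambda>x. f (p + x)) has_fps_expansion F"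
  shows "fps_expansion f p = F"
  using fps_expansion_unique_complex[OF has_fps_expansion_at[OF assms(1,2)] assms(3)] .

lemma hardy_holomorphic: "f \<in> hardy_space \<Longrightarrow> f holomorphic_on unit_disc"
  by (simp add: hardy_space_def)

text \<open>Cauchy's estimate on a circle about \<open>p\<close>, where \<open>f\<close> is
  controlled by the point evaluation bound.\<close>

lemma taylor_coeff_bounded:
  assumes p: "p \<in> unit_disc"
  obtains C where "0 \<le> C" "\<And>f. f \<in> hardy_space \<Longrightarrow> cmod (taylor_coeff f p n) \<le> C * hardy_norm f"
proof -
  \<comment> \<open>Half the distance from \<open>p\<close> to the unit circle keeps the closed disc
    about \<open>p\<close> inside radius \<open>s\<close> < 1.\<close>
  define r where "r = (1 - cmod p) / 2"
  have p1: "cmod p < 1" using p by simp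
  then have r: "0 < r" "cmod p + r < 1" by (simp_all add: r_def field_simps)
  define s where "s = cmod p + r"
  have s: "0 \<le> s" "s < 1" using r by (simp_all add: s_def)
  then have s2: "s\<^sup>2 < 1" by (simp add: abs_square_less_1)
  have sub: "cball p r \<subseteq> unit_disc"
  proof
    fix x assume "x \<in> cball p r"
    then have "cmod (x - p) \<le> r" by (simp add: dist_norm norm_minus_commute)
    with norm_triangle_sub[of x p] r show "x \<in> unit_disc" by simp
  qed
  have "cmod (taylor_coeff f p n) \<le> 1 / sqrt (1 - s\<^sup>2) / r ^ n * hardy_norm f"
    if f: "f \<in> hardy_space" for f
  proof -
    have "cmod ((deriv ^^ n) f p) \<le> fact n * (hardy_norm f / sqrt (1 - s\<^sup>2)) / r ^ n"
    proof (rule Cauchy_inequality[OF _ _ r(1)])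
      show "f holomorphic_on ball p r"
        using holomorphic_on_subset[OF hardy_holomorphic[OF f]] sub ball_subset_cball by blast
      show "continuous_on (cball p r) f"
        using holomorphic_on_subset[OF hardy_holomorphic[OF f] sub] by (rule holomorphic_on_imp_continuous_on)
      fix x assume "cmod (p - x) = r"
      then have "cmod x \<le> s"
        using norm_triangle_sub[of x p] by (simp add: s_def norm_minus_commute)
      then show "cmod (f x) \<le> hardy_norm f / sqrt (1 - s\<^sup>2)"
        by (rule hardy_point_bound[OF f _ s(2)])
    qed
    then have "cmod ((deriv ^^ n) f p) / fact n \<le> fact n * (hardy_norm f / sqrt (1 - s\<^sup>2)) / r ^ n / fact n"
      by (rule divide_right_mono) simp
    then show ?thesis by (simp add: fps_expansion_def norm_divide)
  qed
  with r s2 show thesis by (intro that[of "1 / sqrt (1 - s\<^sup>2) / r ^ n"]) auto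
qed

text \<open>\<open>K 0\<close> is the reproducing kernel at \<open>p\<close>, and \<open>K n\<close>
  represents the n-th derivative at \<open>p\<close> divided by n!.\<close>

lemma taylor_coeff_representation:
  assumes p: "p \<in> unit_disc"
  obtains K where "\<And>n. K n \<in> hardy_space"
    "\<And>f n. f \<in> hardy_space \<Longrightarrow> taylor_coeff f p n = hardy_inner f (K n)"
proof -
  have "\<exists>k. k \<in> hardy_space \<and> (\<forall>f\<in>hardy_space. taylor_coeff f p n = hardy_inner f k)" for n
  proof -
    obtain C where C: "0 \<le> C" "\<And>f. f \<in> hardy_space \<Longrightarrow> cmod (taylor_coeff f p n) \<le> C * hardy_norm f"
      using p by (rule taylor_coeff_bounded[of p n]) blast
    have at: "(\<lambda>x. f (p + x)) has_fps_expansion fps_expansion f p" if "f \<in> hardy_space" for f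
      using that p by (intro has_fps_expansion_at hardy_holomorphic)
    obtain k where "k \<in> hardy_space" "\<And>f. f \<in> hardy_space \<Longrightarrow> taylor_coeff f p n = hardy_inner f k"
    proof (rule hardy_Riesz[of "\<lambda>f. taylor_coeff f p n" C])
      fix f g assume "f \<in> hardy_space" "g \<in> hardy_space"
      then have "fps_expansion (\<lambda>z. f z + g z) p = fps_expansion f p + fps_expansion g p"
        by (intro fps_expansion_at_eqI has_fps_expansion_add at p hardy_holomorphic hardy_space_add)
      then show "taylor_coeff (\<lambda>z. f z + g z) p n = taylor_coeff f p n + taylor_coeff g p n"
        by simp
    next
      fix c f assume "f \<in> hardy_space"
      then have "fps_expansion (\<lambda>z. c * f z) p = fps_const c * fps_expansion f p"
        by (intro fps_expansion_at_eqI has_fps_expansion_cmult_left at p hardy_holomorphic hardy_space_cmult)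
      then show "taylor_coeff (\<lambda>z. c * f z) p n = c * taylor_coeff f p n"
        by simp
    qed (use C in auto)
    then show ?thesis by blast
  qed
  then show thesis using that by metis
qed

lemma hardy_poly:
  "(\<lambda>z. if z \<in> unit_disc then poly P z else 0) \<in> hardy_space"
proof -
  have s: "summable (\<lambda>n. (cmod (coeff P n))\<^sup>2)"
    by (rule summable_finite[of "{..degree P}"]) (auto simp: coeff_eq_0)
  have "(\<Sum>n. coeff P n * z ^ n) = poly P z" for z
    unfolding poly_altdef by (rule suminf_finite) (auto simp: coeff_eq_0)
  then have "hardy_of_coeffs (coeff P) = (\<lambda>z. if z \<in> unit_disc then poly P z else 0)"
    by (simp add: hardy_of_coeffs_def fun_eq_iff)
  with hardy_of_coeffs_in_hardy_space[OF s] show ?thesis by simp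
qed

lemma eventually_in_unit_disc:
  assumes "p \<in> unit_disc"
  shows "eventually (\<lambda>x. p + x \<in> unit_disc) (nhds 0)"
proof -
  have "eventually (\<lambda>x. x \<in> (\<lambda>x. p + x) -` unit_disc) (nhds 0)"
    using assms by (intro eventually_nhds_in_open open_vimage continuous_intros) auto
  then show ?thesis by simp
qed

text \<open>The function is (z - p)^n on the disc. These powers later witness the independence of
  the Taylor functionals.\<close>

lemma hardy_monomial_at:
  assumes p: "p \<in> unit_disc"
  obtains f where "f \<in> hardy_space" "fps_expansion f p = fps_X ^ n"
proof -
  define f where "f = (\<lambda>z. if z \<in> unit_disc then poly ([:-p, 1:] ^ n) z else 0)"
  have f: "f \<in> hardy_space" unfolding f_def by (rule hardy_poly)
  have "eventually (\<lambda>x. f (p + x) = x ^ n) (nhds 0)"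
    using eventually_in_unit_disc[OF p] by eventually_elim (simp add: f_def)
  then have "(\<lambda>x. f (p + x)) has_fps_expansion fps_X ^ n"
    by (subst has_fps_expansion_cong[OF _ refl]) (auto intro: has_fps_expansion_fps_X_power)
  from fps_expansion_at_eqI[OF hardy_holomorphic[OF f] p this] f show thesis
    by (intro that)
qed

text \<open>Since \<open>\<phi>\<close> fixes \<open>p\<close>, its increment has leading term
  \<open>deriv \<phi> p\<close> times x. Substituting it into a series of order at least
  \<open>n\<close> scales the coefficient of x^n by the n-th power of this derivative, and
  multiplying by \<open>\<psi>\<close> scales it by \<open>\<psi> p\<close>.\<close>

lemma taylor_coeff_weighted_composition:
  assumes \<phi>: "\<phi> holomorphic_on unit_disc" "\<phi> ` unit_disc \<subseteq> unit_disc" and \<psi>: "\<psi> holomorphic_on unit_disc"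
    and p: "p \<in> unit_disc" "\<phi> p = p"
    and f: "f holomorphic_on unit_disc" and 0: "\<And>j. j < n \<Longrightarrow> taylor_coeff f p j = 0"
  shows "taylor_coeff (weighted_composition \<psi> \<phi> f) p n = \<psi> p * deriv \<phi> p ^ n * taylor_coeff f p n"
proof -
  let ?F = "fps_expansion f p" and ?\<Psi> = "fps_expansion \<psi> p"
  \<comment> \<open>Subtracting \<open>p\<close> removes the constant term, so that composition of
    formal power series is available.\<close>
  define \<Phi> where "\<Phi> = fps_expansion \<phi> p - fps_const p"
  have \<Phi>0: "fps_nth \<Phi> 0 = 0" and \<Phi>1: "fps_nth \<Phi> 1 = deriv \<phi> p"
    by (simp_all add: \<Phi>_def fps_expansion_def p)
  have W: "weighted_composition \<psi> \<phi> f holomorphic_on unit_disc"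
  proof -
    have "(\<lambda>z. \<psi> z * f (\<phi> z)) holomorphic_on unit_disc"
      using holomorphic_on_compose_gen[OF \<phi>(1) f \<phi>(2)] \<psi> by (intro holomorphic_on_mult) (auto simp: o_def)
    then show ?thesis
      by (rule holomorphic_transform) (simp add: weighted_composition_def)
  qed
  have "(\<lambda>x. \<phi> (p + x) - p) has_fps_expansion \<Phi>"
    unfolding \<Phi>_def by (intro has_fps_expansion_diff has_fps_expansion_at \<phi> p has_fps_expansion_const)
  from has_fps_expansion_compose[OF has_fps_expansion_at[OF f p(1)] this \<Phi>0]
  have "(\<lambda>x. \<psi> (p + x) * ((\<lambda>x. f (p + x)) \<circ> (\<lambda>x. \<phi> (p + x) - p)) x)
          has_fps_expansion ?\<Psi> * (?F oo \<Phi>)"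
    by (intro has_fps_expansion_mult has_fps_expansion_at \<psi> p)
  moreover have "eventually (\<lambda>x. weighted_composition \<psi> \<phi> f (p + x)
                   = \<psi> (p + x) * ((\<lambda>x. f (p + x)) \<circ> (\<lambda>x. \<phi> (p + x) - p)) x) (nhds 0)"
    using eventually_in_unit_disc[OF p(1)] by eventually_elim (simp add: weighted_composition_def)
  ultimately have "(\<lambda>x. weighted_composition \<psi> \<phi> f (p + x)) has_fps_expansion ?\<Psi> * (?F oo \<Phi>)"
    by (subst has_fps_expansion_cong[OF _ refl]) auto
  then have "taylor_coeff (weighted_composition \<psi> \<phi> f) p n = fps_nth (?\<Psi> * (?F oo \<Phi>)) n"
    using fps_expansion_at_eqI[OF W p(1)] by simp
  also have "\<dots> = (\<Sum>i=0..n. fps_nth ?\<Psi> i * fps_nth (?F oo \<Phi>) (n - i))"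
    by (rule fps_mult_nth)
  \<comment> \<open>The coefficients of the composite below \<open>n\<close> vanish together with
    those of \<open>?F\<close>, which leaves only the constant term of
    \<open>?\<Psi>\<close>.\<close>
  also have "\<dots> = (\<Sum>i=0..n. if i = 0 then \<psi> p * fps_nth (?F oo \<Phi>) n else 0)"
  proof (rule sum.cong)
    fix i assume i: "i \<in> {0..n}"
    have "fps_nth (?F oo \<Phi>) (n - i) = 0" if "i \<noteq> 0"
      unfolding fps_compose_nth using that i by (intro sum.neutral) (auto simp: 0)
    then show "fps_nth ?\<Psi> i * fps_nth (?F oo \<Phi>) (n - i) = (if i = 0 then \<psi> p * fps_nth (?F oo \<Phi>) n else 0)"
      by (simp add: fps_expansion_def)
  qed simp
  also have "\<dots> = \<psi> p * fps_nth (?F oo \<Phi>) n"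
    by simp
  \<comment> \<open>Only the n-th power of \<open>\<Phi>\<close> remains, and its coefficient of x^n
    is the n-th power of the linear coefficient of \<open>\<Phi>\<close>.\<close>
  also have "fps_nth (?F oo \<Phi>) n = (\<Sum>i=0..n. if i = n then fps_nth ?F n * deriv \<phi> p ^ n else 0)"
    unfolding fps_compose_nth
    by (rule sum.cong) (auto simp: 0 startsby_zero_power_nth_same[OF \<Phi>0] \<Phi>1[simplified])
  also have "\<dots> = fps_nth ?F n * deriv \<phi> p ^ n"
    by simp
  finally show ?thesis by (simp add: mult_ac)
qed

section \<open>The eigenbasis of a normal weighted composition operator and its spectrum\<close>

theorem proposition11:
  fixes \<phi> \<psi> :: "complex \<Rightarrow> complex" and p :: complex
  assumes "\<phi> holomorphic_on unit_disc"
    and "\<phi> ` unit_disc \<subseteq> unit_disc"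
    and "\<psi> holomorphic_on unit_disc"
    and "bounded_operator (weighted_composition \<psi> \<phi>)"
    and "p \<in> unit_disc" and "\<phi> p = p"
    and "normal_operator (weighted_composition \<psi> \<phi>)"
  shows "operator_spectrum (weighted_composition \<psi> \<phi>)
           = closure {\<psi> p * deriv \<phi> p ^ n | n :: nat. True}"
proof -
  let ?W = "weighted_composition \<psi> \<phi>"
  define l where "l = (\<lambda>n. \<psi> p * deriv \<phi> p ^ n)"
  have WH: "?W f \<in> hardy_space" if "f \<in> hardy_space" for f
    using assms(4) that by (simp add: bounded_operator_def)
  obtain K where K: "\<And>n. K n \<in> hardy_space"
    "\<And>f n. f \<in> hardy_space \<Longrightarrow> taylor_coeff f p n = hardy_inner f (K n)"
    using assms(5) by (rule taylor_coeff_representation) blast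
  have indep: "\<exists>f\<in>hardy_space. (\<forall>j<n. hardy_inner f (K j) = 0) \<and> hardy_inner f (K n) \<noteq> 0" for n
  proof -
    obtain f where "f \<in> hardy_space" "fps_expansion f p = fps_X ^ n"
      using assms(5) by (rule hardy_monomial_at)
    then show ?thesis by (intro bexI[of _ f]) (auto simp: K(2)[symmetric])
  qed
  obtain e c where e: "\<And>n. e n \<in> hardy_space"
    and on: "\<And>m n. hardy_inner (e m) (e n) = (if m = n then 1 else 0)"
    and ker: "\<And>f n. f \<in> hardy_space \<Longrightarrow>
       (\<forall>j<n. hardy_inner f (e j) = 0) \<longleftrightarrow> (\<forall>j<n. hardy_inner f (K j) = 0)"
    and c: "\<And>f n. f \<in> hardy_space \<Longrightarrow> (\<forall>j<n. hardy_inner f (K j) = 0) \<Longrightarrow>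
       hardy_inner f (e n) = c n * hardy_inner f (K n)"
    by (rule hardy_orthonormalization[of K, OF K(1) indep]) blast
  \<comment> \<open>Orthogonality to the earlier \<open>e j\<close> means vanishing to order
    \<open>n\<close> at \<open>p\<close>. There \<open>?W\<close> scales the n-th Taylor coefficient
    by \<open>l n\<close>, and \<open>c n\<close> converts between \<open>K n\<close> and
    \<open>e n\<close> for both \<open>f\<close> and its image.\<close>
  have triangular: "hardy_inner (?W f) (e n) = l n * hardy_inner f (e n)"
    if f: "f \<in> hardy_space" and 0: "\<forall>j<n. hardy_inner f (e j) = 0" for f n
  proof -
    have fK: "\<forall>j<n. hardy_inner f (K j) = 0" using ker[OF f] 0 by simp
    have WK: "hardy_inner (?W f) (K j) = l j * hardy_inner f (K j)" if "j \<le> n" for j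
      using taylor_coeff_weighted_composition[OF assms(1,2,3,5,6) hardy_holomorphic[OF f], of j] that fK
      by (simp add: K(2)[OF f] K(2)[OF WH[OF f]] l_def)
    then have "\<forall>j<n. hardy_inner (?W f) (K j) = 0" using fK by simp
    from c[OF WH[OF f] this] c[OF f fK] WK[of n] show ?thesis by simp
  qed
  have eigen: "?W (e n) = (\<lambda>z. l n * e n z)
      \<and> (\<forall>f\<in>hardy_space. hardy_inner (?W f) (e n) = l n * hardy_inner f (e n))" for n
  proof (induction n rule: less_induct)
    case (less n)
    have coeff: "hardy_inner (?W f) (e n) = l n * hardy_inner f (e n)" if f: "f \<in> hardy_space" for f
    proof -
      \<comment> \<open>Split off the projection to the earlier eigenvectors. By induction
        \<open>?W\<close> keeps it in their span, orthogonal to \<open>e n\<close>, while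
        \<open>triangular\<close> handles the remainder \<open>g\<close>.\<close>
      let ?p = "\<lambda>z. \<Sum>j<n. hardy_inner f (e j) * e j z"
      define g where "g = (\<lambda>z. f z - ?p z)"
      have p: "?p \<in> hardy_space" and g: "g \<in> hardy_space"
        unfolding g_def by (simp_all add: e f hardy_space_sum hardy_space_cmult hardy_space_diff)
      have "?W ?p = (\<lambda>z. \<Sum>j<n. hardy_inner f (e j) * ?W (e j) z)"
        by (auto simp: weighted_composition_def fun_eq_iff sum_distrib_left mult_ac)
      also have "\<dots> = (\<lambda>z. \<Sum>j<n. (hardy_inner f (e j) * l j) * e j z)"
        using less by (simp add: mult_ac)
      finally have "hardy_inner (?W ?p) (e n) = (\<Sum>j<n. hardy_inner f (e j) * l j * hardy_inner (e j) (e n))"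
        by (simp add: hardy_inner_sum_left hardy_inner_cmult_left hardy_space_cmult e)
      also have "\<dots> = 0" by (simp add: on)
      finally have Wp: "hardy_inner (?W ?p) (e n) = 0" .
      have pe: "hardy_inner ?p (e n) = 0"
        by (simp add: hardy_inner_sum_left hardy_inner_cmult_left hardy_space_cmult e on)
      have "?W f = (\<lambda>z. ?W g z + ?W ?p z)"
        by (auto simp: weighted_composition_def fun_eq_iff g_def algebra_simps)
      then have "hardy_inner (?W f) (e n) = hardy_inner (?W g) (e n)"
        using Wp by (simp add: hardy_inner_add_left WH g p e)
      also have "\<dots> = l n * hardy_inner g (e n)"
        unfolding g_def using hardy_orthonormal_residual[OF f e on]
        by (intro triangular g[unfolded g_def]) blast
      also have "hardy_inner g (e n) = hardy_inner f (e n)"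
        unfolding g_def using pe by (simp add: hardy_inner_diff_left f p e)
      finally show ?thesis .
    qed
    \<comment> \<open>The relation \<open>coeff\<close> makes \<open>e n\<close> an eigenvector of
      the adjoint; normality makes it one of \<open>?W\<close>.\<close>
    with normal_operator_eigenvector[OF assms(7) e, of n "l n"] show ?case by blast
  qed
  have total: "f = (\<lambda>z. 0)" if f: "f \<in> hardy_space" and 0: "\<And>n. hardy_inner f (e n) = 0" for f
  proof
    fix z
    \<comment> \<open>Kernel equality is taken at \<open>Suc n\<close> so that the index
      \<open>n\<close> itself is covered.\<close>
    have "taylor_coeff f p n = 0" for n
      using ker[OF f, of "Suc n"] 0 by (simp add: K(2)[OF f])
    then have "(deriv ^^ n) f p = 0" for n by (simp add: fps_expansion_def)
    \<comment> \<open>The identity theorem on the connected disc.\<close>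
    then have "f z = 0" if "z \<in> unit_disc"
      using that assms(5) holomorphic_fun_eq_0_on_connected[OF hardy_holomorphic[OF f], of p z] by simp
    with f show "f z = 0" by (auto simp: hardy_space_def)
  qed
  have "operator_spectrum ?W = closure (range l)"
    using eigen by (intro operator_spectrum_orthonormal_eigenbasis[OF assms(4) e on total]) auto
  also have "range l = {\<psi> p * deriv \<phi> p ^ n | n :: nat. True}"
    by (auto simp: l_def)
  finally show ?thesis .
qed

end
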